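(* Suppose that every sensor is connected to an anchor either directly or indirectly. Fix the penalty parameter $\gamma>0$ arbitrarily. Let $\mathcal{N}$ be the set of stationary points of $F(\cdot,\cdot;\gamma)$ on $\mathbb{R}^{d\times m}\times\mathbb{R}^{d\times m}$. Then, for any initial point $(U^{(0)},V^{(0)})\in\mathbb{R}^{d\times m}\times\mathbb{R}^{d\times m}$, the sequence $\{(U^{(p)},V^{(p)})\}_{p=1}^\infty$ generated by the block coordinate descent algorithm satisfies $$\lim_{p\to\infty}\inf_{(U,V)\in\mathcal{N}}\|(U^{(p)},V^{(p)})-(U,V)\|_F = 0.$$ In particular, any accumulation point $(U^*,V^* )$ of the generated sequence is a stationary point of $F(\cdot,\cdot;\gamma)$.
   Context: Setting (sensor network localization). Let $d,m,n$ be positive integers. Sensors are indexed by $1,\dots,m$ and anchors by $m+1,\dots,m+n$; anchor $k$ has known position $\bm{a}_k\in\mathbb{R}^d$. $E_{\mathrm{ss}}$ is a set of unordered pairs $ij=\{i,j\}$ of distinct sensors, and $E_{\mathrm{sa}}$ is a set of pairs $ik=\{i,k\}$ consisting of a sensor $i$ and an anchor $k$. For each $ij\in E_{\mathrm{ss}}$ and $ik\in E_{\mathrm{sa}}$, nonnegative real numbers $d_{ij}$ (symmetric in $i,j$) and $d_{ik}$ (measured distances) are given. "Every sensor is connected to an anchor either directly or indirectly" means: in the graph with vertex set $\{1,\dots,m+n\}$ and edge set $E_{\mathrm{ss}}\cup E_{\mathrm{sa}}$, for every sensor there is a path from it to some anchor. For $U=(\bm{u}_1,\dots,\bm{u}_m)$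 and $V=(\bm{v}_1,\dots,\bm{v}_m)$ in $\mathbb{R}^{d\times m}$ (columns $\bm{u}_i,\bm{v}_i\in\mathbb{R}^d$) define $$f(U,V) := \frac{1}{2}\sum_{ij\in E_{\mathrm{ss}}}\left((\bm{u}_i-\bm{u}_j)^\top(\bm{v}_i-\bm{v}_j)-d_{ij}^2\right)^2 + \frac{1}{2}\sum_{ik\in E_{\mathrm{sa}}}\left((\bm{a}_k-\bm{u}_i)^\top(\bm{a}_k-\bm{v}_i)-d_{ik}^2\right)^2,$$ $$F(U,V;\gamma) := \frac{\gamma}{2}\|U-V\|_F^2+f(U,V),$$ where $\|\cdot\|_F$ is the Frobenius norm. $F$ is written with the columns of $U$ and/or $V$ listed as separate arguments when convenient. A stationary point of $F(\cdot,\cdot;\gamma)$ is a point at which its gradient with respect to $(U,V)$ vanishes. Block coordinate descent algorithm (with fixed $\gamma>0$): given an initial point $(U^{(0)},V^{(0)})$, for $p=1,2,\dots$ compute, for $i=1,\dots,m$ in this order, $$\bm{u}_i^{(p)} = \mathop{\mathrm{argmin}}_{\bm{u}_i\in\mathbb{R}^d}F(\bm{u}_1^{(p)},\dots,\bm{u}_{i-1}^{(p)},\bm{u}_i,\bm{u}_{i+1}^{(p-1)},\dots,\bm{u}_m^{(p-1)},V^{(p-1)};\gamma),$$ and then, for $i=1,\dots,m$ in this order, $$\bm{v}_i^{(p)} = \mathop{\mathrm{argmin}}_{\bm{v}_i\in\mathbb{R}^d}F(U^{(p)},\bm{v}_1^{(p)},\dots,\bm{v}_{i-1}^{(p)},\bm{v}_i,\bm{v}_{i+1}^{(p-1)},\dots,\bm{v}_m^{(p-1)};\gamma),$$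 with $U^{(p)}=(\bm{u}_1^{(p)},\dots,\bm{u}_m^{(p)})$ and $V^{(p)}=(\bm{v}_1^{(p)},\dots,\bm{v}_m^{(p)})$ (each minimizer exists and is unique). The generated sequence is the infinite sequence obtained without applying any stopping test. *)

theory Defs
  imports "HOL-Analysis.Analysis"
begin

text \<open>
  Sensors are the elements of a finite linearly ordered type \<open>'m\<close> (the order is the one in
  which the algorithm visits them), anchors those of a finite type \<open>'n\<close>. A matrix
  \<open>(u\<^sub>1, \<dots>, u\<^sub>m)\<close> with \<open>d\<close> rows is an element \<open>U\<close> of \<open>real ^ 'd ^ 'm\<close>, whose component
  \<open>U $ i\<close> is the column \<open>u\<^sub>i\<close>. The library norm on this type, and on pairs \<open>(U, V)\<close>, is the
  Euclidean norm of the list of all entries, that is, the Frobenius norm.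

  A sensor-sensor edge is a two-element set of sensors and \<open>dss\<close> assigns a distance to such
  a set, which makes it symmetric. As sensors and anchors have different types, a
  sensor-anchor edge is given by an element of \<open>'m \<times> 'n\<close>.
\<close>

definition snl_f ::
  "('n \<Rightarrow> real ^ 'd) \<Rightarrow> 'm set set \<Rightarrow> ('m \<times> 'n) set \<Rightarrow> ('m set \<Rightarrow> real) \<Rightarrow> ('m \<times> 'n \<Rightarrow> real)
    \<Rightarrow> real ^ 'd ^ 'm::{finite,linorder} \<Rightarrow> real ^ 'd ^ 'm::{finite,linorder} \<Rightarrow> real" where
  "snl_f a Ess Esa dss dsa U V =
     1 / 2 * (\<Sum>(i, j) | i < j \<and> {i, j} \<in> Ess.
       ((U $ i - U $ j) \<bullet> (V $ i - V $ j) - (dss {i, j})\<^sup>2)\<^sup>2) +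
     1 / 2 * (\<Sum>(i, k) \<in> Esa. ((a k - U $ i) \<bullet> (a k - V $ i) - (dsa (i, k))\<^sup>2)\<^sup>2)"

definition snl_F ::
  "('n \<Rightarrow> real ^ 'd) \<Rightarrow> 'm set set \<Rightarrow> ('m \<times> 'n) set \<Rightarrow> ('m set \<Rightarrow> real) \<Rightarrow> ('m \<times> 'n \<Rightarrow> real)
    \<Rightarrow> real \<Rightarrow> real ^ 'd ^ 'm::{finite,linorder} \<Rightarrow> real ^ 'd ^ 'm::{finite,linorder} \<Rightarrow> real" where
  "snl_F a Ess Esa dss dsa \<gamma> U V =
     \<gamma> / 2 * (norm (U - V))\<^sup>2 + snl_f a Ess Esa dss dsa U V"

definition snl_edges :: "'m set set \<Rightarrow> ('m \<times> 'n) set \<Rightarrow> ('m + 'n) set set" where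
  "snl_edges Ess Esa = (\<lambda>e. Inl ` e) ` Ess \<union> (\<lambda>(i, k). {Inl i, Inr k}) ` Esa"

definition path_between :: "'v set set \<Rightarrow> 'v \<Rightarrow> 'v \<Rightarrow> 'v list \<Rightarrow> bool" where
  "path_between E x y vs \<longleftrightarrow> vs \<noteq> [] \<and> hd vs = x \<and> last vs = y \<and> distinct vs \<and>
     successively (\<lambda>v w. {v, w} \<in> E) vs"

definition stationary_points :: "('a::real_inner \<Rightarrow> real) \<Rightarrow> 'a set" where
  "stationary_points g = {z. GDERIV g z :> 0}"

definition update_column :: "'a ^ 'm \<Rightarrow> 'm \<Rightarrow> 'a \<Rightarrow> 'a ^ 'm::finite" where
  "update_column X i x = (\<chi> j. if j = i then x else X $ j)"

definition minimize_column :: "('a ^ 'm \<Rightarrow> real) \<Rightarrow> 'm \<Rightarrow> 'a ^ 'm \<Rightarrow> 'a ^ 'm::finite" where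
  "minimize_column g i X =
     update_column X i (arg_min (\<lambda>x. g (update_column X i x)) (\<lambda>_. True))"

text \<open>
  For the objective \<open>snl_F\<close> with \<open>\<gamma> > 0\<close> the minimizer selected by \<open>arg_min\<close> is unique, as the
  objective is a strictly convex quadratic function of each single column.

  The columns are replaced one after the other in increasing order, so that when column \<open>i\<close>
  is treated the earlier columns are already the new ones and the later ones still the old.
\<close>

definition sweep ::
  "('a ^ 'm::{finite,linorder} \<Rightarrow> real) \<Rightarrow> 'a ^ 'm::{finite,linorder}
    \<Rightarrow> 'a ^ 'm::{finite,linorder}" where
  "sweep g X = fold (minimize_column g) (sorted_list_of_set UNIV) X"

primrec bcd ::
  "('a ^ 'm::{finite,linorder} \<Rightarrow> 'a ^ 'm::{finite,linorder} \<Rightarrow> real)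
    \<Rightarrow> ('a ^ 'm::{finite,linorder}) \<times> ('a ^ 'm::{finite,linorder}) \<Rightarrow> nat
    \<Rightarrow> ('a ^ 'm::{finite,linorder}) \<times> ('a ^ 'm::{finite,linorder})" where
  "bcd G z 0 = z"
| "bcd G z (Suc p) =
     (let (U, V) = bcd G z p;
          U' = sweep (\<lambda>X. G X V) U;
          V' = sweep (\<lambda>Y. G U' Y) V
      in (U', V'))"

end

theory Submission imports Defs begin

text \<open>
  With \<open>\<gamma> > 0\<close> the objective \<open>F\<close> is, for fixed \<open>V\<close>, a convex quadratic function of \<open>U\<close> whose
  curvature is at least \<open>\<gamma>\<close>, and likewise with the roles exchanged, because \<open>F\<close> is symmetric.
  Hence every single column update lowers \<open>F\<close> by at least \<open>\<gamma> / 4\<close> times the squared length of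
  the step (\<open>minimize_column_decrease\<close>). As the values of \<open>F\<close> along the iteration decrease and
  stay bounded, the decrease per sweep, and with it every step within a sweep, tends to zero.

  Suppose now that a subsequence of the iterates converges to \<open>z\<close>. The intermediate points of the
  corresponding sweeps converge to \<open>z\<close> too. Each of them, right after the update of column
  \<open>i\<close>, minimizes \<open>F\<close> in that column, and this is a family of inequalities between values of a
  continuous function, so \<open>z\<close> inherits it (\<open>column_minimal_limit\<close>). Thus \<open>z\<close> minimizes \<open>F\<close>
  in each of its \<open>2m\<close> columns separately, the derivative of \<open>F\<close> at \<open>z\<close> vanishes on a spanning
  set of directions, and \<open>z\<close> is stationary (\<open>stationary_if_column_minimal\<close>).

  Connectivity of the network enters through boundedness of the sublevel sets
  (\<open>snl_F_bounded_sublevel\<close>). A bound on \<open>F\<close> bounds \<open>U - V\<close>, and for each edge it bounds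
  the inner product of the difference vectors of the edge in \<open>U\<close> and in \<open>V\<close> from above. By polarization
  the edge difference of \<open>U + V\<close> is bounded, and adding this up along a path to an anchor,
  whose position is given, bounds each column of \<open>U + V\<close>. So the iterates remain in a compact
  set. A sequence in a compact set approaches any set that contains all its limit points
  (\<open>tendsto_distance_if_limit_points\<close>).
\<close>

section \<open>Column updates of a strongly convex function\<close>

lemma update_column_nth [simp]: "update_column X i x $ i = x"
  by (simp add: update_column_def)

lemma update_column_twice [simp]: "update_column (update_column X i y) i x = update_column X i x"
  by (simp add: update_column_def vec_eq_iff)

lemma update_column_triv [simp]: "update_column X i (X $ i) = X"
  by (simp add: update_column_def vec_eq_iff)

lemma tendsto_update_column [tendsto_intros]:
  assumes "(X \<longlongrightarrow> X') F" "(x \<longlongrightarrow> x') F"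
  shows "((\<lambda>p. update_column (X p) i (x p)) \<longlongrightarrow> update_column X' i x') F"
  unfolding update_column_def
  by (intro tendsto_vec_lambda) (auto intro: assms tendsto_vec_nth)

lemma continuous_on_update_column: "continuous_on S (\<lambda>x. update_column X i x)"
  unfolding continuous_on_def by (auto intro!: tendsto_intros)

definition column_minimal :: "('a ^ 'm \<Rightarrow> real) \<Rightarrow> 'm \<Rightarrow> 'a ^ 'm::finite \<Rightarrow> bool" where
  "column_minimal g i X \<longleftrightarrow> (\<forall>x. g X \<le> g (update_column X i x))"

lemma column_minimal_add_axis:
  fixes X :: "'a::ab_group_add ^ 'm::finite"
  assumes "column_minimal g i X"
  shows "g X \<le> g (X + axis i h)"
proof -
  have "X + axis i h = update_column X i (X $ i + h)"
    by (simp add: update_column_def axis_def vec_eq_iff)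
  then show ?thesis
    using assms by (metis column_minimal_def)
qed

text \<open>
  Strong convexity in midpoint form, with \<open>c\<close> measuring the curvature: for a quadratic
  function of curvature at least \<open>\<gamma>\<close> the inequality holds with \<open>c = \<gamma> / 4\<close>.
\<close>

locale midpoint_strongly_convex =
  fixes g :: "'a::euclidean_space ^ 'm::{finite,linorder} \<Rightarrow> real" and c :: real
  assumes modulus_pos: "c > 0"
    and continuous: "continuous_on UNIV g"
    and bounded_sublevel: "bounded {X. g X \<le> K}"
    and midpoint: "c * (norm (X - Y))\<^sup>2 \<le> g X + g Y - 2 * g ((1 / 2) *\<^sub>R (X + Y))"
begin

text \<open>
  The function of column \<open>i\<close> is continuous and has compact sublevel sets, so it attains its
  minimum; only then does \<open>arg_min\<close> denote a minimizer.
\<close>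

lemma column_minimal_minimize_column: "column_minimal g i (minimize_column g i X)"
proof -
  let ?h = "\<lambda>x. g (update_column X i x)"
  let ?S = "{x. ?h x \<le> ?h (X $ i)}"
  have cont: "continuous_on UNIV ?h"
    by (rule continuous_on_compose2[OF continuous continuous_on_update_column]) auto
  have "?S \<subseteq> (\<lambda>Y. Y $ i) ` {Y. g Y \<le> ?h (X $ i)}"
    by (auto intro!: rev_image_eqI[where x = "update_column X i _"])
  then have "bounded ?S"
    by (metis bounded_subset bounded_linear_image bounded_linear_vec_nth bounded_sublevel)
  moreover have "closed ?S"
    by (intro closed_Collect_le cont continuous_on_const)
  ultimately have "compact ?S"
    by (simp add: compact_eq_bounded_closed)
  moreover have "X $ i \<in> ?S" by simp
  then have "?S \<noteq> {}" by blast
  ultimately have "\<exists>x0\<in>?S. \<forall>y\<in>?S. ?h x0 \<le> ?h y"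
    by (rule continuous_attains_inf) (rule continuous_on_subset[OF cont subset_UNIV])
  then obtain x0 where x0: "x0 \<in> ?S" "\<And>y. y \<in> ?S \<Longrightarrow> ?h x0 \<le> ?h y"
    by blast
  have "?h x0 \<le> ?h y" for y
  proof (cases "y \<in> ?S")
    case False
    then show ?thesis using x0(1) by simp
  qed (rule x0(2))
  then have "is_arg_min ?h (\<lambda>_. True) x0"
    by (simp add: is_arg_min_linorder)
  then have "is_arg_min ?h (\<lambda>_. True) (arg_min ?h (\<lambda>_. True))"
    unfolding arg_min_def by (rule someI)
  then show ?thesis
    by (simp add: column_minimal_def minimize_column_def is_arg_min_linorder)
qed

text \<open>
  The midpoint of the old and the new point differs from the new point in column \<open>i\<close> only, hence
  its value is not below the minimum. The midpoint inequality turns this into a gap between the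
  old value and the minimum.
\<close>

lemma minimize_column_decrease:
  "c * (norm (minimize_column g i X - X))\<^sup>2 \<le> g X - g (minimize_column g i X)"
proof -
  let ?Y = "minimize_column g i X"
  have "(1 / 2) *\<^sub>R (?Y + X) = update_column ?Y i ((1 / 2) *\<^sub>R (?Y $ i + X $ i))"
    by (simp add: minimize_column_def update_column_def vec_eq_iff)
  then have "g ?Y \<le> g ((1 / 2) *\<^sub>R (?Y + X))"
    using column_minimal_minimize_column[of i X] by (metis column_minimal_def)
  then show ?thesis
    using midpoint[of ?Y X] by argo
qed

text \<open>
  A decrease of \<open>\<delta>\<close> over a whole run leaves at most \<open>\<delta>\<close> for each step, so each step has length at
  most \<open>sqrt (\<delta> / c)\<close>, and by the triangle inequality all points visited are close to the start.
  Among them, for each processed column \<open>i\<close>, is the one just after \<open>i\<close> was updated.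
\<close>

lemma fold_minimize_column:
  assumes "Y = fold (minimize_column g) is X"
  shows "g Y \<le> g X"
    and "norm (Y - X) \<le> length is * sqrt ((g X - g Y) / c)"
    and "i \<in> set is \<Longrightarrow> \<exists>W. column_minimal g i W \<and>
           norm (W - X) \<le> length is * sqrt ((g X - g Y) / c)"
proof -
  have "g Y \<le> g X \<and> norm (Y - X) \<le> length is * sqrt ((g X - g Y) / c) \<and>
      (\<forall>i\<in>set is. \<exists>W. column_minimal g i W \<and> norm (W - X) \<le> length is * sqrt ((g X - g Y) / c))"
    using assms
  proof (induction "is" arbitrary: X)
    case Nil
    then show ?case by simp
  next
    case (Cons k ks)
    let ?X = "minimize_column g k X" and ?r = "sqrt ((g X - g Y) / c)"
    have IH: "g Y \<le> g ?X" "norm (Y - ?X) \<le> length ks * sqrt ((g ?X - g Y) / c)"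
      "\<And>i. i \<in> set ks \<Longrightarrow> \<exists>W. column_minimal g i W \<and>
         norm (W - ?X) \<le> length ks * sqrt ((g ?X - g Y) / c)"
      using Cons.IH[of ?X] Cons.prems by auto
    have "0 \<le> c * (norm (?X - X))\<^sup>2" using modulus_pos by simp
    then have desc: "g ?X \<le> g X" using minimize_column_decrease[of k X] by linarith
    have "(norm (?X - X))\<^sup>2 \<le> (g X - g Y) / c"
      using minimize_column_decrease[of k X] IH(1) modulus_pos
      by (simp add: pos_le_divide_eq mult.commute)
    then have step: "norm (?X - X) \<le> ?r"
      by (simp add: real_le_rsqrt)
    have mono: "length ks * sqrt ((g ?X - g Y) / c) \<le> length ks * ?r"
      using desc modulus_pos by (intro mult_left_mono real_sqrt_le_mono divide_right_mono) auto
    have near: "norm (W - X) \<le> length (k # ks) * ?r"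
      if "norm (W - ?X) \<le> length ks * sqrt ((g ?X - g Y) / c)" for W
      using norm_triangle_ineq[of "W - ?X" "?X - X"] that step mono by (simp add: algebra_simps)
    have here: "norm (?X - X) \<le> length (k # ks) * ?r"
      using IH(1) modulus_pos by (intro near) simp
    have "\<exists>W. column_minimal g i W \<and> norm (W - X) \<le> length (k # ks) * ?r"
      if "i \<in> set (k # ks)" for i
    proof (cases "i = k")
      case True
      then show ?thesis using column_minimal_minimize_column here by blast
    next
      case False
      then show ?thesis using IH(3)[of i] near that by auto
    qed
    then show ?case
      using near[OF IH(2)] order_trans[OF IH(1) desc] by blast
  qed
  then show "g Y \<le> g X" and "norm (Y - X) \<le> length is * sqrt ((g X - g Y) / c)"
    and "i \<in> set is \<Longrightarrow> \<exists>W. column_minimal g i W \<and>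
           norm (W - X) \<le> length is * sqrt ((g X - g Y) / c)"
    by auto
qed

lemma sweep_descent: "g (sweep g X) \<le> g X"
  and sweep_displacement: "norm (sweep g X - X) \<le> CARD('m) * sqrt ((g X - g (sweep g X)) / c)"
  and sweep_passes_column_minimal: "\<exists>W. column_minimal g i W \<and>
        norm (W - X) \<le> CARD('m) * sqrt ((g X - g (sweep g X)) / c)"
proof -
  have "i \<in> set (sorted_list_of_set UNIV)" by simp
  from fold_minimize_column(1,2)[OF sweep_def] fold_minimize_column(3)[OF sweep_def this]
  show "g (sweep g X) \<le> g X"
    and "norm (sweep g X - X) \<le> CARD('m) * sqrt ((g X - g (sweep g X)) / c)"
    and "\<exists>W. column_minimal g i W \<and>
        norm (W - X) \<le> CARD('m) * sqrt ((g X - g (sweep g X)) / c)"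
    by (simp_all only: length_sorted_list_of_set)
qed

end

section \<open>Stationarity of limits\<close>

text \<open>
  The other block \<open>B\<close> may move along with \<open>W\<close>, since \<open>G\<close> is jointly continuous. This is needed
  because each sweep minimizes with respect to a different second block.
\<close>

lemma column_minimal_limit:
  fixes W :: "nat \<Rightarrow> 'a::real_normed_vector ^ 'm::finite" and B :: "nat \<Rightarrow> 'b::topological_space"
  assumes "continuous_on UNIV (\<lambda>z. G (fst z) (snd z))"
    and "\<And>p. column_minimal (\<lambda>X. G X (B p)) i (W p)"
    and "W \<longlonglongrightarrow> W'" and "B \<longlonglongrightarrow> B'"
  shows "column_minimal (\<lambda>X. G X B') i W'"
  unfolding column_minimal_def
proof
  fix x
  have lim: "(\<lambda>p. G (Y p) (B p)) \<longlonglongrightarrow> G Y' B'" if "Y \<longlonglongrightarrow> Y'" for Y Y'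
    using continuous_on_tendsto_compose[OF assms(1) tendsto_Pair[OF that assms(4)]] by simp
  show "G W' B' \<le> G (update_column W' i x) B'"
    using assms(2)
    by (intro LIMSEQ_le[OF lim[OF assms(3)] lim[OF tendsto_update_column[OF assms(3) tendsto_const]]])
      (auto simp: column_minimal_def)
qed

text \<open>
  Minimality in a single column does not give minimality of \<open>G\<close>, but the derivative is linear and
  the directions that change a single column span the whole space.
\<close>

lemma stationary_if_column_minimal:
  fixes G :: "'a::euclidean_space ^ 'm::finite \<Rightarrow> 'a ^ 'm \<Rightarrow> real"
  assumes diff: "(\<lambda>z. G (fst z) (snd z)) differentiable (at (U, V))"
    and U: "\<And>i. column_minimal (\<lambda>X. G X V) i U"
    and V: "\<And>i. column_minimal (\<lambda>Y. G U Y) i V"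
  shows "(U, V) \<in> stationary_points (\<lambda>(U, V). G U V)"
proof -
  let ?f = "\<lambda>z. G (fst z) (snd z)"
  obtain f' where f': "(?f has_derivative f') (at (U, V))"
    using diff by (auto simp: differentiable_def)
  interpret f': bounded_linear f' using f' by (rule has_derivative_bounded_linear)
  have axis_linear: "bounded_linear (axis i :: 'a \<Rightarrow> 'a ^ 'm)" for i
    by (rule linear_conv_bounded_linear[THEN iffD1], rule linearI)
      (auto simp: axis_def vec_eq_iff)
  have line: "f' (L x) = 0"
    if L: "bounded_linear L" and min: "\<And>y. ?f (U, V) \<le> ?f ((U, V) + L y)"
    for L :: "'a \<Rightarrow> _" and x
  proof -
    have L0: "L 0 = 0"
      using L by (simp add: bounded_linear.linear linear_0)
    have "((\<lambda>y. (U, V) + L y) has_derivative (\<lambda>y. 0 + L y)) (at 0)"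
      by (intro has_derivative_add has_derivative_const bounded_linear_imp_has_derivative L)
    moreover have "(?f has_derivative f') (at ((U, V) + L 0))"
      using f' by (simp only: L0 add_0_right)
    ultimately have "((\<lambda>y. ?f ((U, V) + L y)) has_derivative (\<lambda>y. f' (0 + L y))) (at 0)"
      by (rule has_derivative_compose)
    then have "((\<lambda>y. ?f ((U, V) + L y)) has_derivative (\<lambda>y. f' (L y))) (at 0)"
      by (simp only: add_0_left)
    then have "(\<lambda>y. f' (L y)) = (\<lambda>y. 0)"
    proof (rule differential_zero_maxmin[OF UNIV_I open_UNIV])
      have "?f ((U, V) + L 0) \<le> ?f ((U, V) + L y)" for y
        unfolding L0 using min[of y] by simp
      then show "(\<forall>y\<in>UNIV. ?f ((U, V) + L y) \<le> ?f ((U, V) + L 0))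
          \<or> (\<forall>y\<in>UNIV. ?f ((U, V) + L 0) \<le> ?f ((U, V) + L y))"
        by blast
    qed
    then show ?thesis by (rule fun_cong)
  qed
  have left: "f' (axis i x, 0) = 0" for i x
    using column_minimal_add_axis[OF U]
    by (intro line[where L = "\<lambda>x. (axis i x, 0)"] bounded_linear_Pair axis_linear bounded_linear_zero) simp
  have right: "f' (0, axis i x) = 0" for i x
    using column_minimal_add_axis[OF V]
    by (intro line[where L = "\<lambda>x. (0, axis i x)"] bounded_linear_Pair axis_linear bounded_linear_zero) simp
  have expand: "X = (\<Sum>i\<in>UNIV. axis i (X $ i))" for X :: "'a ^ 'm"
    by (simp add: vec_eq_iff axis_def)
  have "f' (X, Y) = 0" for X Y
  proof -
    have "(X, Y) = (\<Sum>i\<in>UNIV. (axis i (X $ i), 0)) + (\<Sum>i\<in>UNIV. (0, axis i (Y $ i)))"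
      by (subst expand[of X], subst expand[of Y]) (simp add: sum_prod)
    then show ?thesis
      by (simp add: f'.add f'.sum left right)
  qed
  then have "f' = (\<lambda>h. 0 \<bullet> h)" by auto
  then show ?thesis
    using f' by (simp add: stationary_points_def gderiv_def case_prod_beta')
qed

text \<open>
  Points staying away from \<open>N\<close> along a subsequence would accumulate, by boundedness, at a point
  that belongs to \<open>N\<close>. The infimum is taken in the extended reals, where over an empty \<open>N\<close> it would be
  infinite; the argument also excludes this case, as a bounded sequence has a limit point.
\<close>

lemma tendsto_distance_if_limit_points:
  fixes x :: "nat \<Rightarrow> 'a::euclidean_space"
  assumes bdd: "bounded (range x)"
    and lim: "\<And>z r. strict_mono r \<Longrightarrow> (x \<circ> r) \<longlonglongrightarrow> z \<Longrightarrow> z \<in> N"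
  shows "(\<lambda>p. INF z\<in>N. ereal (norm (x p - z))) \<longlonglongrightarrow> 0"
proof (rule order_tendstoI)
  fix e :: ereal assume "e < 0"
  moreover have "0 \<le> (INF z\<in>N. ereal (norm (x p - z)))" for p by (simp add: INF_greatest)
  ultimately show "\<forall>\<^sub>F p in sequentially. e < (INF z\<in>N. ereal (norm (x p - z)))"
    by (auto intro!: always_eventually intro: less_le_trans)
next
  fix e :: ereal assume e: "0 < e"
  show "\<forall>\<^sub>F p in sequentially. (INF z\<in>N. ereal (norm (x p - z))) < e"
  proof (rule ccontr)
    assume "\<not> ?thesis"
    then have "\<exists>\<^sub>F p in sequentially. \<not> (INF z\<in>N. ereal (norm (x p - z))) < e"
      by (simp add: frequently_def)
    then have "infinite {p. \<not> (INF z\<in>N. ereal (norm (x p - z))) < e}"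
      unfolding cofinite_eq_sequentially[symmetric] frequently_cofinite .
    from infinite_enumerate[OF this] obtain r :: "nat \<Rightarrow> nat" where r: "strict_mono r"
      and far: "\<And>p. e \<le> (INF z\<in>N. ereal (norm (x (r p) - z)))"
      by (auto simp: not_less)
    have "range (x \<circ> r) \<subseteq> range x" by auto
    then have "bounded (range (x \<circ> r))"
      by (rule bounded_subset[OF bdd])
    then obtain s l where s: "strict_mono s" and l: "((x \<circ> r) \<circ> s) \<longlonglongrightarrow> l"
      using bounded_imp_convergent_subsequence by metis
    have "l \<in> N"
      using lim[of "r \<circ> s" l] r s l by (simp add: strict_mono_o o_assoc)
    then have "e \<le> ereal (norm (x (r (s p)) - l))" for p
      using far[of "s p"] INF_lower[of l N "\<lambda>z. ereal (norm (x (r (s p)) - z))"]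
      by (meson order_trans)
    moreover have "(\<lambda>p. ereal (norm (x (r (s p)) - l))) \<longlonglongrightarrow> ereal 0"
      using l by (auto simp: o_def tendsto_norm_zero_iff LIM_zero_iff)
    ultimately have "e \<le> ereal 0"
      by (meson LIMSEQ_le_const)
    then show False using e by (simp add: zero_ereal_def)
  qed
qed

section \<open>Alternating sweeps over two blocks\<close>

locale alternating_descent =
  fixes G :: "'a::euclidean_space ^ 'm::{finite,linorder} \<Rightarrow> 'a ^ 'm::{finite,linorder} \<Rightarrow> real"
    and c :: real
  assumes modulus_pos: "c > 0"
    and differentiable: "(\<lambda>z. G (fst z) (snd z)) differentiable (at z)"
    and bounded_sublevel: "bounded {z. G (fst z) (snd z) \<le> K}"
    and midpoint_left: "c * (norm (X - Y))\<^sup>2 \<le> G X V + G Y V - 2 * G ((1 / 2) *\<^sub>R (X + Y)) V"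
    and midpoint_right: "c * (norm (X - Y))\<^sup>2 \<le> G U X + G U Y - 2 * G U ((1 / 2) *\<^sub>R (X + Y))"
begin

lemma continuous: "continuous_on UNIV (\<lambda>z. G (fst z) (snd z))"
  by (simp add: differentiable differentiable_imp_continuous_within continuous_at_imp_continuous_on)

sublocale left: midpoint_strongly_convex "\<lambda>X. G X V" c for V
proof
  show "continuous_on UNIV (\<lambda>X. G X V)"
    using continuous_on_compose2[OF continuous, of UNIV "\<lambda>X. (X, V)"] by (simp add: continuous_intros)
  have "{X. G X V \<le> K} \<subseteq> fst ` {z. G (fst z) (snd z) \<le> K}" for K
    by (auto intro!: rev_image_eqI[where x = "(_, V)"])
  then show "bounded {X. G X V \<le> K}" for K
    by (rule bounded_subset[OF bounded_fst[OF bounded_sublevel]])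
qed (use modulus_pos midpoint_left in auto)

sublocale right: midpoint_strongly_convex "\<lambda>Y. G U Y" c for U
proof
  show "continuous_on UNIV (\<lambda>Y. G U Y)"
    using continuous_on_compose2[OF continuous, of UNIV "\<lambda>Y. (U, Y)"] by (simp add: continuous_intros)
  have "{Y. G U Y \<le> K} \<subseteq> snd ` {z. G (fst z) (snd z) \<le> K}" for K
    by (auto intro!: rev_image_eqI[where x = "(U, _)"])
  then show "bounded {Y. G U Y \<le> K}" for K
    by (rule bounded_subset[OF bounded_snd[OF bounded_sublevel]])
qed (use modulus_pos midpoint_right in auto)

context
  fixes z0 :: "('a ^ 'm::{finite,linorder}) \<times> ('a ^ 'm::{finite,linorder})"
begin

abbreviation "U p \<equiv> fst (bcd G z0 p)"
abbreviation "V p \<equiv> snd (bcd G z0 p)"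

lemma U_Suc: "U (Suc p) = sweep (\<lambda>X. G X (V p)) (U p)"
  and V_Suc: "V (Suc p) = sweep (\<lambda>Y. G (U (Suc p)) Y) (V p)"
  by (simp_all add: case_prod_beta' Let_def)

lemma half_step_descent: "G (U (Suc p)) (V p) \<le> G (U p) (V p)"
  "G (U (Suc p)) (V (Suc p)) \<le> G (U (Suc p)) (V p)"
  unfolding U_Suc V_Suc by (rule left.sweep_descent right.sweep_descent)+

lemma decseq_objective: "decseq (\<lambda>p. G (U p) (V p))"
  by (intro decseq_SucI order_trans[OF half_step_descent(2) half_step_descent(1)])

lemma bounded_bcd: "bounded (range (bcd G z0))"
  by (rule bounded_subset[OF bounded_sublevel[of "G (U 0) (V 0)"]])
    (use decseqD[OF decseq_objective, of 0] in auto)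

text \<open>
  The values are bounded below because \<open>G\<close> is continuous on the compact closure of the iterates.
\<close>

lemma objective_convergent: "convergent (\<lambda>p. G (U p) (V p))"
proof -
  let ?f = "\<lambda>z. G (fst z) (snd z)"
  have "compact (?f ` closure (range (bcd G z0)))"
    by (intro compact_continuous_image continuous_on_subset[OF continuous])
      (auto simp: bounded_bcd compact_closure)
  then have "bounded (?f ` range (bcd G z0))"
    by (meson bounded_subset closure_subset compact_imp_bounded image_mono)
  then have "Bseq (\<lambda>p. G (U p) (V p))"
    by (simp add: Bseq_eq_bounded image_image)
  then show ?thesis
    using Bseq_monoseq_convergent decseq_imp_monoseq[OF decseq_objective] by blast
qed

text \<open>
  Both half steps are nonnegative parts of the decrease over a full iteration, which is a
  difference of consecutive terms of a convergent sequence.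
\<close>

lemma decrease_tendsto_0: "(\<lambda>p. G (U p) (V p) - G (U (Suc p)) (V p)) \<longlonglongrightarrow> 0"
  "(\<lambda>p. G (U (Suc p)) (V p) - G (U (Suc p)) (V (Suc p))) \<longlonglongrightarrow> 0"
proof -
  obtain l where l: "(\<lambda>p. G (U p) (V p)) \<longlonglongrightarrow> l"
    using objective_convergent by (auto simp: convergent_def)
  then have total: "(\<lambda>p. G (U p) (V p) - G (U (Suc p)) (V (Suc p))) \<longlonglongrightarrow> 0"
    using tendsto_diff[OF l LIMSEQ_Suc[OF l]] by simp
  show "(\<lambda>p. G (U p) (V p) - G (U (Suc p)) (V p)) \<longlonglongrightarrow> 0"
    by (rule tendsto_sandwich[OF _ _ tendsto_const total])
      (use half_step_descent in \<open>auto simp del: bcd.simps\<close>)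
  show "(\<lambda>p. G (U (Suc p)) (V p) - G (U (Suc p)) (V (Suc p))) \<longlonglongrightarrow> 0"
    by (rule tendsto_sandwich[OF _ _ tendsto_const total])
      (use half_step_descent in \<open>auto simp del: bcd.simps\<close>)
qed

text \<open>
  Three kinds of points have the same limit as the iterates of the subsequence: the points visited within a
  sweep over \<open>U\<close>, the new block \<open>U (Suc (r p))\<close>, and the points visited within the sweep over
  \<open>V\<close> that follows. The second is what the sweep over \<open>V\<close> keeps fixed.
\<close>

lemma limit_point_stationary:
  assumes r: "strict_mono r" and lim: "(\<lambda>p. bcd G z0 (r p)) \<longlonglongrightarrow> z"
  shows "z \<in> stationary_points (\<lambda>(U, V). G U V)"
proof -
  have small: "(\<lambda>p. CARD('m) * sqrt (\<delta> (r p) / c)) \<longlonglongrightarrow> 0" if "\<delta> \<longlonglongrightarrow> 0" for \<delta>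
  proof -
    have "(\<lambda>p. \<delta> (r p)) \<longlonglongrightarrow> 0"
      using LIMSEQ_subseq_LIMSEQ[OF that r] by (simp only: o_def)
    then have "(\<lambda>p. CARD('m) * sqrt (\<delta> (r p) / c)) \<longlonglongrightarrow> CARD('m) * sqrt (0 / c)"
      using modulus_pos by (intro tendsto_mult tendsto_const tendsto_real_sqrt tendsto_divide) simp_all
    then show ?thesis by simp
  qed
  have near: "Y \<longlonglongrightarrow> X'" if "X \<longlonglongrightarrow> X'" "\<And>p. norm (Y p - X p) \<le> e p" "e \<longlonglongrightarrow> 0"
    for X Y :: "nat \<Rightarrow> 'a ^ 'm::{finite,linorder}" and X' e
  proof -
    have "(\<lambda>p. Y p - X p) \<longlonglongrightarrow> 0"
      by (rule Lim_null_comparison[OF always_eventually that(3)]) (simp add: that(2))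
    then show ?thesis
      using tendsto_add[of "\<lambda>p. Y p - X p" 0 _ X X'] that(1) by simp
  qed
  have U: "(\<lambda>p. U (r p)) \<longlonglongrightarrow> fst z" and V: "(\<lambda>p. V (r p)) \<longlonglongrightarrow> snd z"
    by (rule tendsto_fst[OF lim], rule tendsto_snd[OF lim])
  note e1 = small[OF decrease_tendsto_0(1)] and e2 = small[OF decrease_tendsto_0(2)]
  have U1: "(\<lambda>p. U (Suc (r p))) \<longlonglongrightarrow> fst z"
    by (rule near[OF U _ e1]) (unfold U_Suc, rule left.sweep_displacement)
  have "column_minimal (\<lambda>X. G X (snd z)) i (fst z)" for i
  proof -
    have "\<exists>W. column_minimal (\<lambda>X. G X (V (r p))) i W \<and> norm (W - U (r p))
        \<le> CARD('m) * sqrt ((G (U (r p)) (V (r p)) - G (U (Suc (r p))) (V (r p))) / c)" for p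
      unfolding U_Suc by (rule left.sweep_passes_column_minimal)
    then obtain W where W: "\<And>p. column_minimal (\<lambda>X. G X (V (r p))) i (W p)"
      "\<And>p. norm (W p - U (r p))
        \<le> CARD('m) * sqrt ((G (U (r p)) (V (r p)) - G (U (Suc (r p))) (V (r p))) / c)"
      by metis
    show ?thesis
      by (rule column_minimal_limit[OF continuous W(1) near[OF U W(2) e1] V])
  qed
  moreover have "column_minimal (\<lambda>Y. G (fst z) Y) i (snd z)" for i
  proof -
    have "\<exists>W. column_minimal (\<lambda>Y. G (U (Suc (r p))) Y) i W \<and> norm (W - V (r p))
        \<le> CARD('m) * sqrt ((G (U (Suc (r p))) (V (r p)) - G (U (Suc (r p))) (V (Suc (r p)))) / c)" for p
      unfolding V_Suc by (rule right.sweep_passes_column_minimal)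
    then obtain W where W: "\<And>p. column_minimal (\<lambda>Y. G (U (Suc (r p))) Y) i (W p)"
      "\<And>p. norm (W p - V (r p))
        \<le> CARD('m) * sqrt ((G (U (Suc (r p))) (V (r p)) - G (U (Suc (r p))) (V (Suc (r p)))) / c)"
      by metis
    \<comment> \<open>Here the block being minimized is the second argument of \<open>G\<close>, so \<open>G\<close> is used with its arguments swapped.\<close>
    have "continuous_on UNIV (\<lambda>z. (\<lambda>Y X. G X Y) (fst z) (snd z))"
      using continuous_on_compose2[OF continuous, of UNIV "\<lambda>z. (snd z, fst z)"]
      by (simp add: continuous_intros)
    then show ?thesis
      by (rule column_minimal_limit[OF _ W(1) near[OF V W(2) e2] U1])
  qed
  ultimately show ?thesis
    using stationary_if_column_minimal[of G "fst z" "snd z"] differentiable by simp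
qed

lemma distance_to_stationary_points_tendsto_0:
  "(\<lambda>p. INF z \<in> stationary_points (\<lambda>(U, V). G U V). ereal (norm (bcd G z0 p - z))) \<longlonglongrightarrow> 0"
  by (rule tendsto_distance_if_limit_points[OF bounded_bcd])
    (auto simp: o_def intro: limit_point_stationary)

end

end

section \<open>The sensor network objective\<close>

lemma snl_f_commute: "snl_f a Ess Esa dss dsa U V = snl_f a Ess Esa dss dsa V U"
  by (simp add: snl_f_def inner_commute)

lemma snl_F_commute: "snl_F a Ess Esa dss dsa \<gamma> U V = snl_F a Ess Esa dss dsa \<gamma> V U"
  by (simp add: snl_F_def snl_f_commute[of _ _ _ _ _ U] norm_minus_commute)

text \<open>
  For fixed \<open>V\<close> each summand is the square of an affine function of \<open>U\<close>, hence convex. The whole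
  strong convexity of \<open>F\<close> thus comes from the penalty term, by the parallelogram law.
\<close>

lemma snl_f_midpoint:
  fixes X Y :: "real ^ 'd ^ 'm::{finite,linorder}"
  shows "2 * snl_f a Ess Esa dss dsa ((1 / 2) *\<^sub>R (X + Y)) V
    \<le> snl_f a Ess Esa dss dsa X V + snl_f a Ess Esa dss dsa Y V"
proof -
  let ?M = "(1 / 2) *\<^sub>R (X + Y)"
  have square: "2 * m\<^sup>2 \<le> s\<^sup>2 + t\<^sup>2" if "2 * m = s + t" for m s t :: real
  proof -
    have "s\<^sup>2 + t\<^sup>2 - 2 * m\<^sup>2 = 2 * (s - m)\<^sup>2"
      using that by (simp add: power2_eq_square algebra_simps) algebra
    then show ?thesis using zero_le_power2[of "s - m"] by linarith
  qed
  have "2 * (\<Sum>(i, j) | i < j \<and> {i, j} \<in> Ess. ((?M $ i - ?M $ j) \<bullet> (V $ i - V $ j) - (dss {i, j})\<^sup>2)\<^sup>2)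
      \<le> (\<Sum>(i, j) | i < j \<and> {i, j} \<in> Ess. ((X $ i - X $ j) \<bullet> (V $ i - V $ j) - (dss {i, j})\<^sup>2)\<^sup>2)
        + (\<Sum>(i, j) | i < j \<and> {i, j} \<in> Ess. ((Y $ i - Y $ j) \<bullet> (V $ i - V $ j) - (dss {i, j})\<^sup>2)\<^sup>2)"
    unfolding sum_distrib_left sum.distrib[symmetric] case_prod_beta'
    by (intro sum_mono square) (simp add: inner_simps field_simps)
  moreover have "2 * (\<Sum>(i, k) \<in> Esa. ((a k - ?M $ i) \<bullet> (a k - V $ i) - (dsa (i, k))\<^sup>2)\<^sup>2)
      \<le> (\<Sum>(i, k) \<in> Esa. ((a k - X $ i) \<bullet> (a k - V $ i) - (dsa (i, k))\<^sup>2)\<^sup>2)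
        + (\<Sum>(i, k) \<in> Esa. ((a k - Y $ i) \<bullet> (a k - V $ i) - (dsa (i, k))\<^sup>2)\<^sup>2)"
    unfolding sum_distrib_left sum.distrib[symmetric] case_prod_beta'
    by (intro sum_mono square) (simp add: inner_simps field_simps)
  ultimately show ?thesis
    unfolding snl_f_def by argo
qed

lemma snl_F_midpoint:
  fixes X Y :: "real ^ 'd ^ 'm::{finite,linorder}"
  shows "\<gamma> / 4 * (norm (X - Y))\<^sup>2
    \<le> snl_F a Ess Esa dss dsa \<gamma> X V + snl_F a Ess Esa dss dsa \<gamma> Y V
      - 2 * snl_F a Ess Esa dss dsa \<gamma> ((1 / 2) *\<^sub>R (X + Y)) V"
proof -
  have "(norm (X - V))\<^sup>2 + (norm (Y - V))\<^sup>2 - 2 * (norm ((1 / 2) *\<^sub>R (X + Y) - V))\<^sup>2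
      = 1 / 2 * (norm (X - Y))\<^sup>2"
    by (simp add: power2_norm_eq_inner inner_simps inner_commute field_simps)
  then have "\<gamma> / 2 * ((norm (X - V))\<^sup>2 + (norm (Y - V))\<^sup>2 - 2 * (norm ((1 / 2) *\<^sub>R (X + Y) - V))\<^sup>2)
      = \<gamma> / 4 * (norm (X - Y))\<^sup>2"
    by simp
  then show ?thesis
    using snl_f_midpoint[of a Ess Esa dss dsa X Y V] unfolding snl_F_def by argo
qed

lemma snl_F_differentiable:
  fixes a :: "'n::finite \<Rightarrow> real ^ 'd"
    and z :: "(real ^ 'd ^ 'm::{finite,linorder}) \<times> (real ^ 'd ^ 'm::{finite,linorder})"
  shows "(\<lambda>z. snl_F a Ess Esa dss dsa \<gamma> (fst z) (snd z)) differentiable (at z)"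
proof -
  have "(\<lambda>z. fst z $ i) differentiable (at z)" "(\<lambda>z. snd z $ i) differentiable (at z)" for i
    by (intro bounded_linear_imp_differentiable bounded_linear_compose[OF bounded_linear_vec_nth]
        bounded_linear_fst bounded_linear_snd)+
  moreover have "fst differentiable (at z)" "snd differentiable (at z)"
    by (intro bounded_linear_imp_differentiable bounded_linear_fst bounded_linear_snd)+
  ultimately show ?thesis
    unfolding snl_F_def snl_f_def power2_norm_eq_inner case_prod_beta'
    by (intro differentiable_add differentiable_mult differentiable_sum differentiable_power
        differentiable_inner differentiable_diff differentiable_const finite ballI) assumption+
qed

text \<open>
  Polarization: \<open>\<parallel>x + y\<parallel>\<^sup>2 = 4 (x \<bullet> y) + \<parallel>x - y\<parallel>\<^sup>2\<close>. It applies to an edge, with \<open>x\<close> and \<open>y\<close> the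
  differences of its ends in \<open>U\<close> and in \<open>V\<close>.
\<close>

lemma norm_add_le_if_inner_near:
  fixes x y :: "'a::real_inner"
  assumes "(x \<bullet> y - \<beta>)\<^sup>2 \<le> s" and "norm (x - y) \<le> t"
  shows "norm (x + y) \<le> sqrt (4 * (\<beta> + sqrt s) + t\<^sup>2)"
proof (rule real_le_rsqrt)
  have "(norm (x + y))\<^sup>2 = 4 * (x \<bullet> y) + (norm (x - y))\<^sup>2"
    by (simp add: power2_norm_eq_inner inner_simps inner_commute)
  moreover have "x \<bullet> y - \<beta> \<le> sqrt s"
    using assms(1) by (rule real_le_rsqrt)
  moreover have "(norm (x - y))\<^sup>2 \<le> t\<^sup>2"
    using assms(2) by (intro power_mono) auto
  ultimately show "(norm (x + y))\<^sup>2 \<le> 4 * (\<beta> + sqrt s) + t\<^sup>2" by argo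
qed

lemma norm_diff_ends_le:
  fixes \<phi> :: "'v \<Rightarrow> 'a::real_normed_vector" and B :: real
  assumes "successively (\<lambda>v w. norm (\<phi> v - \<phi> w) \<le> B) vs" and "vs \<noteq> []" and "B \<ge> 0"
  shows "norm (\<phi> (hd vs) - \<phi> (last vs)) \<le> length vs * B"
  using assms(1,2)
proof (induction vs rule: induct_list012)
  case (3 v w vs)
  then show ?case
    using norm_triangle_ineq[of "\<phi> v - \<phi> w" "\<phi> w - \<phi> (last (w # vs))"]
    by (simp add: algebra_simps)
qed (use assms(3) in auto)

lemma norm_vec_le_if_columns:
  fixes X :: "'a::real_normed_vector ^ 'm::finite" and R :: real
  assumes "\<And>i. norm (X $ i) \<le> R"
  shows "norm X \<le> CARD('m) * R"
proof -
  have "norm X \<le> (\<Sum>i\<in>UNIV. norm (X $ i))"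
    unfolding norm_vec_def by (rule L2_set_le_sum) auto
  also have "\<dots> \<le> CARD('m) * R"
    using sum_bounded_above[of UNIV "\<lambda>i. norm (X $ i)" R] assms by simp
  finally show ?thesis .
qed

lemma snl_F_bounded_sublevel:
  fixes a :: "'n::finite \<Rightarrow> real ^ 'd"
    and Ess :: "'m::{finite,linorder} set set"
  assumes edge_card: "\<forall>e\<in>Ess. card e = 2"
    and connected: "\<forall>i. \<exists>k vs. path_between (snl_edges Ess Esa) (Inl i) (Inr k) vs"
    and \<gamma>: "\<gamma> > 0"
  shows "bounded {z. snl_F a Ess Esa dss dsa \<gamma> (fst z) (snd z) \<le> K}"
proof -
  define D where "D = (\<Sum>e\<in>Ess. (dss e)\<^sup>2) + (\<Sum>e\<in>Esa. (dsa e)\<^sup>2)"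
  have D_ss: "(dss e)\<^sup>2 \<le> D" if "e \<in> Ess" for e
    unfolding D_def using that by (intro add_increasing2 sum_nonneg member_le_sum) auto
  have D_sa: "(dsa e)\<^sup>2 \<le> D" if "e \<in> Esa" for e
    unfolding D_def using that by (intro add_increasing sum_nonneg member_le_sum) auto
  \<comment> \<open>\<open>r\<close> bounds the columns of \<open>U - V\<close>, \<open>B\<close> bounds the differences of \<open>U + V\<close> along
    edges, and \<open>R\<close> bounds the columns of \<open>U\<close> and \<open>V\<close>.\<close>
  define r where "r = sqrt (2 * K / \<gamma>)"
  define B where "B = sqrt (4 * (D + sqrt (2 * K)) + (2 * r)\<^sup>2)"
  define R where "R = CARD('m + 'n) * B + (\<Sum>k\<in>UNIV. norm (2 *\<^sub>R a k)) + r"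
  have "norm (U, V) \<le> CARD('m) * R + CARD('m) * R"
    if le: "snl_F a Ess Esa dss dsa \<gamma> U V \<le> K" for U V
  proof -
    let ?P = "{(i, j). i < j \<and> {i, j} \<in> Ess}"
    let ?ss = "\<lambda>(i, j). ((U $ i - U $ j) \<bullet> (V $ i - V $ j) - (dss {i, j})\<^sup>2)\<^sup>2"
    let ?sa = "\<lambda>(i, k). ((a k - U $ i) \<bullet> (a k - V $ i) - (dsa (i, k))\<^sup>2)\<^sup>2"
    have nonneg: "sum ?ss ?P \<ge> 0" "sum ?sa Esa \<ge> 0" "\<gamma> / 2 * (norm (U - V))\<^sup>2 \<ge> 0"
      using \<gamma> by (auto intro!: sum_nonneg)
    have le': "\<gamma> / 2 * (norm (U - V))\<^sup>2 + (1 / 2 * sum ?ss ?P + 1 / 2 * sum ?sa Esa) \<le> K"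
      using le unfolding snl_F_def snl_f_def .
    then have ss: "?ss e \<le> 2 * K" if "e \<in> ?P" for e
      using member_le_sum[of e ?P ?ss] nonneg that by fastforce
    have sa: "?sa e \<le> 2 * K" if "e \<in> Esa" for e
      using member_le_sum[of e Esa ?sa] nonneg that le' by fastforce
    have "K \<ge> 0" using nonneg le' by argo
    have "(norm (U - V))\<^sup>2 \<le> 2 * K / \<gamma>"
      using nonneg le' \<gamma> by (simp add: field_simps)
    then have "norm (U - V) \<le> r"
      unfolding r_def by (rule real_le_rsqrt)
    then have close: "norm (U $ i - V $ i) \<le> r" for i
      using Finite_Cartesian_Product.norm_nth_le[of "U - V" i] by simp
    have "r \<ge> 0" using \<open>K \<ge> 0\<close> \<gamma> by (simp add: r_def)
    have "D \<ge> 0" by (simp add: D_def sum_nonneg)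
    then have "B \<ge> 0" using \<open>K \<ge> 0\<close> by (simp add: B_def)
    have B: "norm (x + y) \<le> B"
      if "(x \<bullet> y - \<beta>)\<^sup>2 \<le> 2 * K" "norm (x - y) \<le> 2 * r" "\<beta> \<le> D" for x y :: "real ^ 'd" and \<beta>
      using norm_add_le_if_inner_near[OF that(1,2)] that(3) unfolding B_def
      by (smt (verit) real_sqrt_le_mono)
    \<comment> \<open>\<open>U + V\<close>, extended to the anchors by placing both copies of an anchor at its position.\<close>
    define \<phi> where "\<phi> v = (case v of Inl i \<Rightarrow> U $ i + V $ i | Inr k \<Rightarrow> 2 *\<^sub>R a k)" for v
    have sensors: "norm (\<phi> (Inl i) - \<phi> (Inl j)) \<le> B" if "(i, j) \<in> ?P" for i j
    proof -
      have "norm ((U $ i - U $ j) - (V $ i - V $ j)) \<le> 2 * r"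
        using norm_triangle_ineq4[of "U $ i - V $ i" "U $ j - V $ j"] close[of i] close[of j]
        by (simp add: algebra_simps)
      then have "norm ((U $ i - U $ j) + (V $ i - V $ j)) \<le> B"
        using ss[OF that] that by (intro B[of _ _ "(dss {i, j})\<^sup>2"] D_ss) auto
      then show ?thesis by (simp add: \<phi>_def algebra_simps)
    qed
    have anchor: "norm (\<phi> (Inl i) - \<phi> (Inr k)) \<le> B" if "(i, k) \<in> Esa" for i k
    proof -
      have "norm ((a k - U $ i) - (a k - V $ i)) \<le> 2 * r"
        using close[of i] \<open>r \<ge> 0\<close> by (simp add: norm_minus_commute)
      then have "norm ((a k - U $ i) + (a k - V $ i)) \<le> B"
        using sa[OF that] that by (intro B[of _ _ "(dsa (i, k))\<^sup>2"] D_sa) auto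
      moreover have "\<phi> (Inl i) - \<phi> (Inr k) = - ((a k - U $ i) + (a k - V $ i))"
        by (simp add: \<phi>_def scaleR_2 algebra_simps)
      ultimately show ?thesis by (metis norm_minus_cancel)
    qed
    have edge: "norm (\<phi> v - \<phi> w) \<le> B" if vw: "{v, w} \<in> snl_edges Ess Esa" for v w
    proof -
      have "(\<exists>e\<in>Ess. {v, w} = Inl ` e) \<or> (\<exists>e\<in>Esa. {v, w} = {Inl (fst e), Inr (snd e)})"
        using vw by (simp only: snl_edges_def Un_iff image_iff case_prod_beta')
      then show ?thesis
      proof (elim disjE bexE)
        fix e assume e: "e \<in> Ess" "{v, w} = Inl ` e"
        then obtain i j where "e = {i, j}" "i \<noteq> j" using edge_card by (metis card_2_iff)
        then obtain i j where ij: "e = {i, j}" "i < j" by (metis insert_commute neqE)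
        then have "{v, w} = {Inl i, Inl j}" using e by simp
        moreover have "norm (\<phi> (Inl i) - \<phi> (Inl j)) \<le> B" using e ij by (intro sensors) simp
        ultimately show ?thesis
          unfolding doubleton_eq_iff by (metis norm_minus_commute)
      next
        fix e assume "e \<in> Esa" "{v, w} = {Inl (fst e), Inr (snd e)}"
        then show ?thesis
          using anchor[of "fst e" "snd e"] unfolding doubleton_eq_iff
          by (metis norm_minus_commute prod.collapse)
      qed
    qed
    have sum_bound: "norm (U $ i + V $ i) \<le> CARD('m + 'n) * B + (\<Sum>k\<in>UNIV. norm (2 *\<^sub>R a k))" for i
    proof -
      obtain k vs where path: "path_between (snl_edges Ess Esa) (Inl i) (Inr k) vs"
        using connected by blast
      have "norm (\<phi> (hd vs) - \<phi> (last vs)) \<le> length vs * B"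
      proof (rule norm_diff_ends_le)
        have "successively (\<lambda>v w. {v, w} \<in> snl_edges Ess Esa) vs"
          using path by (simp only: path_between_def)
        then show "successively (\<lambda>v w. norm (\<phi> v - \<phi> w) \<le> B) vs"
          by (rule successively_mono) (rule edge)
      qed (use path \<open>B \<ge> 0\<close> in \<open>simp_all add: path_between_def\<close>)
      moreover have "length vs \<le> CARD('m + 'n)"
        using path by (metis path_between_def distinct_card card_mono finite subset_UNIV)
      then have "length vs * B \<le> CARD('m + 'n) * B"
        using \<open>B \<ge> 0\<close> by (intro mult_right_mono) auto
      moreover have "hd vs = Inl i" "last vs = Inr k"
        using path by (auto simp: path_between_def)
      moreover have "norm (2 *\<^sub>R a k) \<le> (\<Sum>k\<in>UNIV. norm (2 *\<^sub>R a k))"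
        by (rule member_le_sum) auto
      ultimately show ?thesis
        using norm_triangle_ineq2[of "U $ i + V $ i" "2 *\<^sub>R a k"] by (simp add: \<phi>_def)
    qed
    have "norm (U $ i) \<le> R" "norm (V $ i) \<le> R" for i
    proof -
      have "2 *\<^sub>R (U $ i) = (U $ i + V $ i) + (U $ i - V $ i)"
        "2 *\<^sub>R (V $ i) = (U $ i + V $ i) - (U $ i - V $ i)"
        by (simp_all add: scaleR_2)
      then have "norm (2 *\<^sub>R (U $ i)) \<le> R" "norm (2 *\<^sub>R (V $ i)) \<le> R"
        unfolding R_def using norm_triangle_ineq[of "U $ i + V $ i" "U $ i - V $ i"]
          norm_triangle_ineq4[of "U $ i + V $ i" "U $ i - V $ i"] sum_bound[of i] close[of i]
        by (simp_all del: norm_scaleR)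
      then show "norm (U $ i) \<le> R" "norm (V $ i) \<le> R"
        using norm_ge_zero[of "U $ i"] norm_ge_zero[of "V $ i"] unfolding norm_scaleR by linarith+
    qed
    then have "norm U \<le> CARD('m) * R" and "norm V \<le> CARD('m) * R"
      by (simp_all add: norm_vec_le_if_columns)
    then show ?thesis
      using norm_Pair_le[of U V] by (meson add_mono order_trans)
  qed
  then have "norm z \<le> CARD('m) * R + CARD('m) * R"
    if "snl_F a Ess Esa dss dsa \<gamma> (fst z) (snd z) \<le> K" for z
    using that by (cases z) simp
  then show ?thesis
    unfolding bounded_iff by blast
qed

section \<open>Convergence of block coordinate descent\<close>

theorem theorem3:
  fixes a :: "'n::finite \<Rightarrow> real ^ 'd"
    and Ess :: "'m::{finite,linorder} set set"
    and Esa :: "('m \<times> 'n) set"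
    and dss :: "'m set \<Rightarrow> real"
    and dsa :: "'m \<times> 'n \<Rightarrow> real"
    and \<gamma> :: real
    and U0 V0 :: "real ^ 'd ^ 'm::{finite,linorder}"
  assumes "\<forall>e\<in>Ess. card e = 2"
    and "\<forall>e\<in>Ess. dss e \<ge> 0"
    and "\<forall>e\<in>Esa. dsa e \<ge> 0"
    and "\<forall>i. \<exists>k vs. path_between (snl_edges Ess Esa) (Inl i) (Inr k) vs"
    and "\<gamma> > 0"
  shows "((\<lambda>p. INF z \<in> stationary_points (\<lambda>(U, V). snl_F a Ess Esa dss dsa \<gamma> U V).
             ereal (norm (bcd (snl_F a Ess Esa dss dsa \<gamma>) (U0, V0) p - z)))
           \<longlonglongrightarrow> 0) \<and>
         (\<forall>z. (\<exists>r. strict_mono r \<and>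
                 (\<lambda>p. bcd (snl_F a Ess Esa dss dsa \<gamma>) (U0, V0) (r p)) \<longlonglongrightarrow> z) \<longrightarrow>
              z \<in> stationary_points (\<lambda>(U, V). snl_F a Ess Esa dss dsa \<gamma> U V))"
proof -
  let ?F = "snl_F a Ess Esa dss dsa \<gamma>"
  interpret alternating_descent ?F "\<gamma> / 4"
  proof
    show "\<gamma> / 4 > 0" using assms(5) by simp
    show "(\<lambda>z. ?F (fst z) (snd z)) differentiable (at z)" for z
      by (rule snl_F_differentiable)
    show "bounded {z. ?F (fst z) (snd z) \<le> K}" for K
      using assms by (intro snl_F_bounded_sublevel)
    show "\<gamma> / 4 * (norm (X - Y))\<^sup>2 \<le> ?F X V + ?F Y V - 2 * ?F ((1 / 2) *\<^sub>R (X + Y)) V" for X Y V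
      by (rule snl_F_midpoint)
    then show "\<gamma> / 4 * (norm (X - Y))\<^sup>2 \<le> ?F U X + ?F U Y - 2 * ?F U ((1 / 2) *\<^sub>R (X + Y))" for U X Y
      by (simp only: snl_F_commute[of _ _ _ _ _ _ U])
  qed
  show ?thesis
    using distance_to_stationary_points_tendsto_0[of "(U0, V0)"]
      limit_point_stationary[where ?z0.0 = "(U0, V0)"] by blast
qed

end
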